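(* Let $f_t(x)$, $x\in\mathbb{R}$, be a time-varying cost function as in the context, and assume: (A1) $x_t^*=\operatorname{argmin}_{x\in\mathbb{R}} f_t(x)$ exists and is bounded for $t\in[T_0,T]$ with the bound independent of $T$, i.e. there is a constant $c_0>0$ independent of $T$ such that $|x_t^*|\le c_0$; (A2) $\tilde x(T)=\operatorname{argmin}_{x\in\mathbb{R}}\int_{T_0}^T f_t(x)\,dt$ exists and is bounded with the bound independent of $T$; (A3) if $x$ is bounded, then $f_t(x)$ is bounded for $t\in[T_0,T]$ with the bound independent of $T$; (A4) the partial derivative $\nabla_t f_t(x)$ of $f_t(x)$ with respect to $t$ is bounded for $t\in[T_0,T]$ with the bound independent of $T$ and $x$. Let $c_1>0$ be a constant such that $|f_t(x_t^* )-f_t(\tilde x(t))|\le c_1$ for any $t\in[T_0,\infty)$ (the existence of such a constant follows from (A1)-(A3)). Let $\sigma>0$ and $m<-1$ be constants, let $b_0>0$ be a constant with $b_0>\left(\frac{-m}{\sigma}\right)^{\frac{1}{1-m}}$, and let the time-varying parameters $\alpha_t,\beta_t$ satisfy $$e^{\alpha_t+\beta_t}-\dot\beta_t e^{\beta_t}=\sigma,\qquad e^{\beta_t}=(t+b_0)^m,$$ and hence $$\dot\beta_t=m(t+b_0)^{-1},\qquad e^{\alpha_t}=m(t+b_0)^{-1}+\sigma(t+b_0)^{-m}>0,$$ $$\dot\alpha_t=\bigl(m(t+b_0)^{-1}+\sigma(t+b_0)^{-m}\bigr)^{-1}\bigl(-m(t+b_0)^{-2}-m\sigma(t+b_0)^{-m-1}\bigr).$$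 Let $x(t)$ be generated by $$\ddot x+(e^{\alpha_t}-\dot\alpha_t)\dot x+e^{2\alpha_t+\beta_t}\nabla f_t(x)=0 .$$ Then, for all $T>T_0$, $$\int_{T_0}^T\bigl(f_t(x(t))-f_t(x_t^* )\bigr)\,dt\le (T-T_0)c_1+\frac{c}{\sigma},$$ with $c$ being some positive constant independent of $T$.
   Context: $T_0$ is the initial time. The optimization problem is the unconstrained online problem $\min_{x\in\mathbb{R}} f_t(x)$, where $f_t(x)\in\mathbb{R}$ is a time-varying, continuously differentiable cost function which is convex in $x$ at any time $t$ and smooth in $t$; at any time $t$, $f_t$ has at least one minimizer. $\nabla f_t(x)$ denotes the derivative with respect to $x$ and $\nabla_t f_t(x)$ the partial derivative with respect to $t$. Dots denote derivatives with respect to $t$. The second-order equation is called the Online Continuous-Time Nesterov Accelerated Gradient (OCT-NAG) algorithm, and the integral on the left of the conclusion is its continuous-time dynamic regret. *)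

theory Defs
  imports "HOL-Analysis.Analysis"
begin

(* f t x is the cost f_t(x) on times t >= T0; g t x and p t x are its partial derivatives with
   respect to x and to t. Time derivatives are taken within {T0..}, hence one-sided at T0.
   Smoothness in t is required only in its weakest form, C^1 in t for each fixed x. *)
definition time_varying_cost ::
    "real \<Rightarrow> (real \<Rightarrow> real \<Rightarrow> real) \<Rightarrow> (real \<Rightarrow> real \<Rightarrow> real) \<Rightarrow> (real \<Rightarrow> real \<Rightarrow> real) \<Rightarrow> bool" where
  "time_varying_cost T0 f g p \<longleftrightarrow>
     (\<forall>t\<ge>T0. convex_on UNIV (f t)) \<and>
     (\<forall>t\<ge>T0. \<forall>x. (f t has_real_derivative g t x) (at x)) \<and>
     (\<forall>t\<ge>T0. continuous_on UNIV (g t)) \<and>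
     (\<forall>x. \<forall>t\<ge>T0. ((\<lambda>s. f s x) has_real_derivative p t x) (at t within {T0..})) \<and>
     (\<forall>x. continuous_on {T0..} (\<lambda>t. p t x))"

definition nag_parameters ::
    "real \<Rightarrow> real \<Rightarrow> real \<Rightarrow> real \<Rightarrow> (real \<Rightarrow> real) \<Rightarrow> (real \<Rightarrow> real) \<Rightarrow> (real \<Rightarrow> real) \<Rightarrow> (real \<Rightarrow> real) \<Rightarrow> bool" where
  "nag_parameters T0 \<sigma> m b0 \<alpha> \<alpha>' \<beta> \<beta>' \<longleftrightarrow>
     (\<forall>t\<ge>T0. (\<alpha> has_real_derivative \<alpha>' t) (at t within {T0..})) \<and>
     (\<forall>t\<ge>T0. (\<beta> has_real_derivative \<beta>' t) (at t within {T0..})) \<and>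
     (\<forall>t\<ge>T0. exp (\<alpha> t + \<beta> t) - \<beta>' t * exp (\<beta> t) = \<sigma>) \<and>
     (\<forall>t\<ge>T0. exp (\<beta> t) = (t + b0) powr m)"

definition oct_nag_solution ::
    "real \<Rightarrow> (real \<Rightarrow> real \<Rightarrow> real) \<Rightarrow> (real \<Rightarrow> real) \<Rightarrow> (real \<Rightarrow> real) \<Rightarrow> (real \<Rightarrow> real) \<Rightarrow> (real \<Rightarrow> real) \<Rightarrow> bool" where
  "oct_nag_solution T0 g \<alpha> \<alpha>' \<beta> x \<longleftrightarrow>
     (\<exists>v a. \<forall>t\<ge>T0.
        (x has_real_derivative v t) (at t within {T0..}) \<and>
        (v has_real_derivative a t) (at t within {T0..}) \<and>
        a t + (exp (\<alpha> t) - \<alpha>' t) * v t + exp (2 * \<alpha> t + \<beta> t) * g t (x t) = 0)"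

(* Since 0 powr m = 0, the equation for exp (\<beta> t) cannot hold at t = - b0, so it
   already excludes T0 + b0 <= 0. *)
lemma nag_parameters_pos:
  assumes "nag_parameters T0 \<sigma> m b0 \<alpha> \<alpha>' \<beta> \<beta>'" and "t \<ge> T0"
  shows "t + b0 > 0"
proof (rule ccontr)
  assume "\<not> t + b0 > 0"
  then have "- b0 \<ge> T0" using assms(2) by simp
  then have "exp (\<beta> (- b0)) = (- b0 + b0) powr m"
    using assms(1) unfolding nag_parameters_def by blast
  then show False by simp
qed

lemma nag_parameters_explicit:
  assumes P: "nag_parameters T0 \<sigma> m b0 \<alpha> \<alpha>' \<beta> \<beta>'" and t: "t \<ge> T0"
  shows "\<beta>' t = m * (t + b0) powr - 1"
    and "exp (\<alpha> t) = m * (t + b0) powr - 1 + \<sigma> * (t + b0) powr - m"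
    and "m * (t + b0) powr - 1 + \<sigma> * (t + b0) powr - m > 0"
    and "\<alpha>' t = (- m * (t + b0) powr - 2 - m * \<sigma> * (t + b0) powr (- m - 1)) /
                (m * (t + b0) powr - 1 + \<sigma> * (t + b0) powr - m)"
proof -
  have unique: "d = e"
    if "(h has_real_derivative d) (at s within {T0..})"
      "(h has_real_derivative e) (at s within {T0..})" "s \<ge> T0"
    for h :: "real \<Rightarrow> real" and d e s
  proof -
    have "{s<..<s + 1} \<subseteq> {T0..} - {s}" using that(3) by auto
    moreover have "s islimpt {s<..<s + 1}"
      by (simp add: islimpt_greaterThanLessThan1)
    ultimately have "s islimpt {T0..}" using islimpt_subset by blast
    then have "at s within {T0..} \<noteq> bot" by (simp add: trivial_limit_within)
    then show ?thesis
      using that(1,2) unfolding has_field_derivative_iff by (rule tendsto_unique)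
  qed
  have pos: "s + b0 > 0" if "s \<ge> T0" for s using nag_parameters_pos[OF P that] .
  have b: "\<beta> s = m * ln (s + b0)" if "s \<ge> T0" for s
  proof -
    have "exp (\<beta> s) = exp (m * ln (s + b0))"
      using P that pos[OF that] unfolding nag_parameters_def by (simp add: powr_def)
    then show ?thesis by simp
  qed
  have b': "\<beta>' s = m * (s + b0) powr - 1" if s: "s \<ge> T0" for s
  proof -
    have "((\<lambda>s. m * ln (s + b0)) has_real_derivative m * (1 / (s + b0))) (at s within {T0..})"
      using pos[OF s] by (auto intro!: derivative_eq_intros)
    then have "(\<beta> has_real_derivative m * (1 / (s + b0))) (at s within {T0..})"
      by (rule has_field_derivative_transform_within[where d = 1]) (use s b in auto)
    then have "\<beta>' s = m * (1 / (s + b0))"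
      using unique P s unfolding nag_parameters_def by blast
    then show ?thesis using pos[OF s] by (simp add: powr_minus_divide)
  qed
  have a: "exp (\<alpha> s) = m * (s + b0) powr - 1 + \<sigma> * (s + b0) powr - m" if s: "s \<ge> T0" for s
  proof -
    have eb: "exp (\<beta> s) = (s + b0) powr m"
      and "exp (\<alpha> s + \<beta> s) - \<beta>' s * exp (\<beta> s) = \<sigma>"
      using P s unfolding nag_parameters_def by auto
    then have "(exp (\<alpha> s) - m * (s + b0) powr - 1) * (s + b0) powr m = \<sigma>"
      using b'[OF s] by (simp add: exp_add algebra_simps)
    moreover have "(s + b0) powr m > 0" using pos[OF s] by simp
    ultimately have "exp (\<alpha> s) - m * (s + b0) powr - 1 = \<sigma> / (s + b0) powr m"
      by (simp add: field_simps)
    then show ?thesis by (simp add: powr_minus_divide)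
  qed
  show "\<beta>' t = m * (t + b0) powr - 1" by (rule b'[OF t])
  show "exp (\<alpha> t) = m * (t + b0) powr - 1 + \<sigma> * (t + b0) powr - m" by (rule a[OF t])
  then show gt: "m * (t + b0) powr - 1 + \<sigma> * (t + b0) powr - m > 0"
    by (metis exp_gt_zero)
  have power: "((\<lambda>s. (s + b0) powr r) has_real_derivative r * (t + b0) powr (r - 1)) (at t within {T0..})"
    for r
    using DERIV_chain'[OF DERIV_add[OF DERIV_ident DERIV_const[of b0]]
        has_real_derivative_powr[OF pos[OF t]]] by simp
  have "((\<lambda>s. m * (s + b0) powr - 1 + \<sigma> * (s + b0) powr - m) has_real_derivative
      m * (- 1 * (t + b0) powr (- 1 - 1)) + \<sigma> * (- m * (t + b0) powr (- m - 1)))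
      (at t within {T0..})"
    by (intro DERIV_add DERIV_cmult power)
  then have d1: "((\<lambda>s. exp (\<alpha> s)) has_real_derivative
      m * (- 1 * (t + b0) powr (- 1 - 1)) + \<sigma> * (- m * (t + b0) powr (- m - 1)))
      (at t within {T0..})"
    by (rule has_field_derivative_transform_within[where d = 1]) (use t a in auto)
  have "(\<alpha> has_real_derivative \<alpha>' t) (at t within {T0..})"
    using P t unfolding nag_parameters_def by auto
  then have "((\<lambda>s. exp (\<alpha> s)) has_real_derivative exp (\<alpha> t) * \<alpha>' t) (at t within {T0..})"
    by (auto intro!: derivative_eq_intros)
  from unique[OF this d1 t]
  have "\<alpha>' t * (m * (t + b0) powr - 1 + \<sigma> * (t + b0) powr - m) =
      - m * (t + b0) powr - 2 - m * \<sigma> * (t + b0) powr (- m - 1)"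
    using a[OF t] by (simp add: algebra_simps)
  then show "\<alpha>' t = (- m * (t + b0) powr - 2 - m * \<sigma> * (t + b0) powr (- m - 1)) /
                (m * (t + b0) powr - 1 + \<sigma> * (t + b0) powr - m)"
    using gt by (metis less_irrefl nonzero_mult_div_cancel_right)
qed

end

theory Submission
  imports Defs
begin

text \<open>
  Put \<open>z = x + exp (- \<alpha>) x'\<close>; the equation of motion becomes
  \<open>z' = - exp (\<alpha> + \<beta>) \<nabla>f\<^sub>t(x)\<close>. For a fixed comparator \<open>u\<close> the Lyapunov function
  \<open>(z - u)\<^sup>2 / 2 + exp \<beta> (f\<^sub>t(x) - f\<^sub>t(u))\<close> grows, by convexity and the parameter identity, at
  rate at most \<open>- \<sigma> (f\<^sub>t(x) - f\<^sub>t(u)) + 2 L exp \<beta>\<close>, and \<open>exp \<beta>\<close> is integrable because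
  \<open>m < - 1\<close>. With \<open>u\<close> the minimizer of the accumulated cost up to the horizon \<open>T\<close>, this bounds
  the static regret by a constant. The static optimum in turn exceeds the integral of the
  pointwise minima by at most \<open>(T - T0) c1\<close>: formally, the minimal accumulated cost up to \<open>t\<close> has
  derivative \<open>f\<^sub>t\<close> at its current minimizer, which is within \<open>c1\<close> of the minimum of \<open>f\<^sub>t\<close>.
  Neither of the two functions of time need be differentiable under the assumptions, so both
  arguments compare increments.
\<close>

section \<open>Monotonicity from increment estimates\<close>

text \<open>The bound \<open>W r - W s \<le> e * (r - s)\<close> is additive over adjacent
  intervals, so bisection extends it from short intervals around each point to
  \<open>{a..b}\<close>; then \<open>e\<close> tends to 0.\<close>

lemma nonincreasing_if_small_increments:
  fixes W :: "real \<Rightarrow> real"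
  assumes "a \<le> b"
    and small: "\<And>t e. \<lbrakk>a \<le> t; t \<le> b; e > 0\<rbrakk> \<Longrightarrow>
      \<exists>d>0. \<forall>s r. a \<le> s \<and> s \<le> t \<and> t \<le> r \<and> r \<le> b \<and> r - s < d \<longrightarrow> W r - W s \<le> e * (r - s)"
  shows "W b \<le> W a"
proof (rule field_le_epsilon)
  fix e :: real assume "e > 0"
  \<comment> \<open>The summand 1 keeps the denominator positive when \<open>a = b\<close>.\<close>
  define e' where "e' = e / (b - a + 1)"
  have e': "e' > 0" using \<open>e > 0\<close> \<open>a \<le> b\<close> by (simp add: e'_def)
  have "a \<le> a \<and> b \<le> b \<longrightarrow> W b - W a \<le> e' * (b - a)"
    using \<open>a \<le> b\<close>
  proof (induction rule: Bolzano[where P = "\<lambda>s r. a \<le> s \<and> r \<le> b \<longrightarrow> W r - W s \<le> e' * (r - s)"])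
    case (trans s t r)
    then show ?case by (auto simp: algebra_simps)
  next
    case (local t)
    then show ?case using small[OF local e'] by meson
  qed
  moreover have "e' * (b - a) \<le> e"
    using \<open>e > 0\<close> \<open>a \<le> b\<close> by (simp add: e'_def field_simps)
  ultimately show "W b \<le> W a + e" by simp
qed

text \<open>A substitute for the derivative test: at each \<open>t\<close> a function
  \<open>K t\<close>, differentiable at \<open>t\<close>, bounds the increments of \<open>W\<close>
  on both sides of \<open>t\<close>.\<close>

lemma nonincreasing_if_increments_dominated:
  fixes W :: "real \<Rightarrow> real"
  assumes "a \<le> b"
    and K: "\<And>t. t \<in> {a..b} \<Longrightarrow> (K t has_real_derivative d t) (at t within {a..b}) \<and> d t \<le> 0"
    and right: "\<And>s t. \<lbrakk>t \<in> {a..b}; s \<in> {a..b}; t \<le> s\<rbrakk> \<Longrightarrow> W s - W t \<le> K t s - K t t"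
    and left: "\<And>s t. \<lbrakk>t \<in> {a..b}; s \<in> {a..b}; s \<le> t\<rbrakk> \<Longrightarrow> W t - W s \<le> K t t - K t s"
  shows "W b \<le> W a"
proof (rule nonincreasing_if_small_increments[OF \<open>a \<le> b\<close>])
  fix t e :: real assume t: "a \<le> t" "t \<le> b" and "e > 0"
  then have tI: "t \<in> {a..b}" by simp
  have "(K t has_derivative (*) (d t)) (at t within {a..b})"
    using K[OF tI] by (simp add: has_field_derivative_def)
  then obtain \<delta> where "\<delta> > 0"
    and \<delta>: "\<And>s. \<lbrakk>s \<in> {a..b}; \<bar>s - t\<bar> < \<delta>\<rbrakk> \<Longrightarrow> \<bar>K t s - K t t - d t * (s - t)\<bar> \<le> e * \<bar>s - t\<bar>"
    using \<open>e > 0\<close> unfolding has_derivative_within_alt by (metis real_norm_def)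
  have "W r - W s \<le> e * (r - s)"
    if "a \<le> s \<and> s \<le> t \<and> t \<le> r \<and> r \<le> b \<and> r - s < \<delta>" for s r
  proof -
    have sr: "s \<in> {a..b}" "r \<in> {a..b}" "\<bar>s - t\<bar> < \<delta>" "\<bar>r - t\<bar> < \<delta>" "s \<le> t" "t \<le> r"
      using that t by auto
    have "d t * (r - t) \<le> 0" "d t * (t - s) \<le> 0"
      using K[OF tI] sr by (simp_all add: mult_nonpos_nonneg)
    \<comment> \<open>The linear parts are nonpositive, and the errors \<open>e * (r - t)\<close>
      and \<open>e * (t - s)\<close> add up to \<open>e * (r - s)\<close>.\<close>
    then have "K t r - K t s \<le> e * (r - s)"
      using \<delta>[OF sr(1,3)] \<delta>[OF sr(2,4)] sr(5,6) by (simp add: algebra_simps abs_le_iff)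
    then show ?thesis using right[OF tI sr(2,6)] left[OF tI sr(1,5)] by simp
  qed
  then show "\<exists>\<delta>>0. \<forall>s r. a \<le> s \<and> s \<le> t \<and> t \<le> r \<and> r \<le> b \<and> r - s < \<delta> \<longrightarrow> W r - W s \<le> e * (r - s)"
    using \<open>\<delta> > 0\<close> by blast
qed

section \<open>Regularity in time\<close>

text \<open>Split \<open>f s (x s) - f t (x t)\<close> at \<open>f t (x s)\<close>: one part
  vanishes by the Lipschitz bound, uniform in \<open>y\<close>, the other by continuity of
  \<open>f t\<close> and \<open>x\<close>.\<close>

lemma continuous_on_along_path:
  fixes f :: "real \<Rightarrow> real \<Rightarrow> real"
  assumes lip: "\<And>s t y. \<lbrakk>s \<in> S; t \<in> S\<rbrakk> \<Longrightarrow> \<bar>f s y - f t y\<bar> \<le> L * \<bar>s - t\<bar>"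
    and cont: "\<And>t. t \<in> S \<Longrightarrow> continuous_on UNIV (f t)"
    and path: "continuous_on S x"
  shows "continuous_on S (\<lambda>t. f t (x t))"
  unfolding continuous_on_def
proof
  fix t assume t: "t \<in> S"
  have "((\<lambda>s. f t (x s)) \<longlongrightarrow> f t (x t)) (at t within S)"
    using continuous_on_compose2[OF cont[OF t] path] t by (simp add: continuous_on_def)
  moreover have "((\<lambda>s. f s (x s) - f t (x s)) \<longlongrightarrow> 0) (at t within S)"
  proof (rule Lim_null_comparison)
    show "\<forall>\<^sub>F s in at t within S. norm (f s (x s) - f t (x s)) \<le> L * \<bar>s - t\<bar>"
      using lip t by (auto simp: eventually_at_filter)
    show "((\<lambda>s. L * \<bar>s - t\<bar>) \<longlongrightarrow> 0) (at t within S)"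
      by (auto intro!: tendsto_eq_intros)
  qed
  ultimately show "((\<lambda>s. f s (x s)) \<longlongrightarrow> f t (x t)) (at t within S)"
    using tendsto_add by fastforce
qed

lemma time_varying_cost_Lipschitz:
  assumes cost: "time_varying_cost T0 f g p"
    and p: "\<And>t y. t \<ge> T0 \<Longrightarrow> \<bar>p t y\<bar> \<le> L"
    and "s \<ge> T0" "t \<ge> T0"
  shows "\<bar>f s y - f t y\<bar> \<le> L * \<bar>s - t\<bar>"
proof -
  have "norm (f s y - f t y) \<le> L * norm (s - t)"
  proof (rule field_differentiable_bound[of "{T0..}" "\<lambda>s. f s y" "\<lambda>s. p s y"])
    show "((\<lambda>s. f s y) has_field_derivative p r y) (at r within {T0..})" if "r \<in> {T0..}" for r
      using cost that by (simp add: time_varying_cost_def)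
  qed (use p assms(3,4) in auto)
  then show ?thesis by simp
qed

section \<open>Static optimum against pointwise minima\<close>

text \<open>Keeping \<open>xtilde s\<close> up to a later time \<open>r\<close> can only cost more
  than switching to \<open>xtilde r\<close>, and on a short interval \<open>{s..r}\<close> its cost
  stays within about \<open>c1\<close> of the pointwise minimum.\<close>

lemma static_optimum_le_pointwise_optimum:
  fixes f :: "real \<Rightarrow> real \<Rightarrow> real"
  assumes "T0 \<le> T"
    and lip: "\<And>s t y. \<lbrakk>s \<ge> T0; t \<ge> T0\<rbrakk> \<Longrightarrow> \<bar>f s y - f t y\<bar> \<le> L * \<bar>s - t\<bar>"
    and min: "\<And>t y. t \<ge> T0 \<Longrightarrow> f t (xstar t) \<le> f t y"
    and leader: "\<And>t y. t > T0 \<Longrightarrow>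
      integral {T0..t} (\<lambda>s. f s (xtilde t)) \<le> integral {T0..t} (\<lambda>s. f s y)"
    and near: "\<And>t. t \<ge> T0 \<Longrightarrow> f t (xtilde t) \<le> f t (xstar t) + c1"
  shows "continuous_on {T0..} (\<lambda>t. f t (xstar t))"
    and "integral {T0..T} (\<lambda>s. f s (xtilde T)) \<le>
      integral {T0..T} (\<lambda>s. f s (xstar s)) + (T - T0) * c1"
proof -
  define \<mu> where "\<mu> = (\<lambda>t. f t (xstar t))"
  have lip_imp_cont: "continuous_on {T0..} h"
    if "\<And>s t. \<lbrakk>s \<ge> T0; t \<ge> T0\<rbrakk> \<Longrightarrow> \<bar>h s - h t\<bar> \<le> L * \<bar>s - t\<bar>" for h :: "real \<Rightarrow> real"
    using continuous_on_along_path[of "{T0..}" "\<lambda>t _. h t" L "\<lambda>_. 0"] that by simp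
  have L: "L \<ge> 0" using lip[of T0 "T0 + 1" 0] by simp
  \<comment> \<open>A pointwise minimum of Lipschitz functions is Lipschitz: each minimizer serves
    as competitor at the other time, so \<open>xstar\<close> itself may jump.\<close>
  have \<mu>_lip: "\<bar>\<mu> s - \<mu> t\<bar> \<le> L * \<bar>s - t\<bar>" if "s \<ge> T0" "t \<ge> T0" for s t
    using min[OF that(1), of "xstar t"] min[OF that(2), of "xstar s"]
      lip[OF that, of "xstar t"] lip[OF that, of "xstar s"] by (auto simp: \<mu>_def)
  have \<mu>_cont: "continuous_on {T0..} \<mu>" by (rule lip_imp_cont[OF \<mu>_lip])
  then show "continuous_on {T0..} (\<lambda>t. f t (xstar t))" by (simp add: \<mu>_def)
  have f_cont: "continuous_on {T0..} (\<lambda>t. f t y)" for y by (rule lip_imp_cont[OF lip])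
  have int: "h integrable_on {s..r}" if "continuous_on {T0..} h" "s \<ge> T0" for h :: "real \<Rightarrow> real" and s r
    by (rule integrable_continuous_interval, rule continuous_on_subset[OF that(1)]) (use that in auto)
  have split: "integral {T0..r} h = integral {T0..s} h + integral {s..r} h"
    if "continuous_on {T0..} h" "T0 \<le> s" "s \<le> r" for h :: "real \<Rightarrow> real" and s r
    using Henstock_Kurzweil_Integration.integral_combine[OF that(2,3) int[OF that(1)]] by simp
  define G where "G t = integral {T0..t} (\<lambda>s. f s (xtilde t)) - integral {T0..t} \<mu> - c1 * (t - T0)" for t
  have incr: "G r - G s \<le> 2 * L * (r - s) * (r - s)" if "T0 \<le> s" "s \<le> r" for s r
  proof -
    have "integral {T0..r} (\<lambda>q. f q (xtilde r)) \<le> integral {T0..r} (\<lambda>q. f q (xtilde s))"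
      \<comment> \<open>At \<open>r = T0\<close> both integrals are over a single point;
        \<open>leader\<close> speaks only of later times.\<close>
      using leader[of r "xtilde s"] that by (cases "r = T0") auto
    moreover have "integral {s..r} (\<lambda>q. f q (xtilde s)) \<le> integral {s..r} (\<lambda>q. \<mu> q + (c1 + 2 * L * (r - s)))"
    proof (rule integral_le)
      fix q assume q: "q \<in> {s..r}"
      \<comment> \<open>One \<open>L * (r - s)\<close> pays for moving the cost from
        \<open>q\<close> to \<open>s\<close>, the other for moving the minimum back.\<close>
      have "f q (xtilde s) \<le> f s (xtilde s) + L * (q - s)" "\<mu> s \<le> \<mu> q + L * (q - s)"
        using lip[of q s "xtilde s"] \<mu>_lip[of s q] q that by auto
      moreover have "L * (q - s) \<le> L * (r - s)" using q L by (simp add: mult_left_mono)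
      ultimately show "f q (xtilde s) \<le> \<mu> q + (c1 + 2 * L * (r - s))"
        using near[OF that(1)] unfolding \<mu>_def by linarith
    qed (use that in \<open>auto intro!: int continuous_intros f_cont \<mu>_cont\<close>)
    moreover have "\<dots> = integral {s..r} \<mu> + (r - s) * (c1 + 2 * L * (r - s))"
      using that by (subst integral_add) (auto intro!: int \<mu>_cont)
    ultimately show ?thesis
      using split[OF f_cont that] split[OF \<mu>_cont that] by (simp add: G_def algebra_simps)
  qed
  have "G T \<le> G T0"
  proof (rule nonincreasing_if_small_increments[OF \<open>T0 \<le> T\<close>])
    fix t e :: real assume "e > 0"
    \<comment> \<open>Increments are quadratically small, so one threshold serves every
      \<open>t\<close>; the summand 1 covers \<open>L = 0\<close>.\<close>
    have "G r - G s \<le> e * (r - s)" if "T0 \<le> s" "s \<le> r" "r - s < e / (2 * L + 1)" for s r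
    proof -
      have "(2 * L + 1) * (r - s) < e" using that(3) L by (simp add: field_simps)
      then have "2 * L * (r - s) \<le> e" using that(2) by (simp add: algebra_simps)
      then have "2 * L * (r - s) * (r - s) \<le> e * (r - s)" using that(2) by (simp add: mult_right_mono)
      then show ?thesis using incr[OF that(1,2)] by simp
    qed
    then show "\<exists>d>0. \<forall>s r. T0 \<le> s \<and> s \<le> t \<and> t \<le> r \<and> r \<le> T \<and> r - s < d \<longrightarrow> G r - G s \<le> e * (r - s)"
      using \<open>e > 0\<close> L by (intro exI[of _ "e / (2 * L + 1)"]) auto
  qed
  then show "integral {T0..T} (\<lambda>s. f s (xtilde T)) \<le>
      integral {T0..T} (\<lambda>s. f s (xstar s)) + (T - T0) * c1"
    by (simp add: G_def \<mu>_def algebra_simps)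
qed

section \<open>Static regret by a Lyapunov function\<close>

text \<open>The Lyapunov inequality integrated in time. The terminal cost gap stays because its sign
  is unknown; the last summand is \<open>2 * L\<close> times the integral of
  \<open>exp (\<beta> t)\<close> over all \<open>t \<ge> T0\<close>.\<close>

lemma nag_static_regret:
  fixes T0 \<sigma> m b0 u :: real
  assumes cost: "time_varying_cost T0 f g p"
    and p: "\<And>t y. t \<ge> T0 \<Longrightarrow> \<bar>p t y\<bar> \<le> L"
    and par: "nag_parameters T0 \<sigma> m b0 \<alpha> \<alpha>' \<beta> \<beta>'"
    and "m < - 1"
    and x: "\<And>t. t \<ge> T0 \<Longrightarrow> (x has_real_derivative v t) (at t within {T0..})"
    and v: "\<And>t. t \<ge> T0 \<Longrightarrow> (v has_real_derivative a t) (at t within {T0..})"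
    and ode: "\<And>t. t \<ge> T0 \<Longrightarrow>
      a t + (exp (\<alpha> t) - \<alpha>' t) * v t + exp (2 * \<alpha> t + \<beta> t) * g t (x t) = 0"
    and "T0 \<le> T"
  shows "continuous_on {T0..} (\<lambda>t. f t (x t))"
    and "\<sigma> * integral {T0..T} (\<lambda>t. f t (x t) - f t u) \<le>
      (x T0 + exp (- \<alpha> T0) * v T0 - u)\<^sup>2 / 2
        + (T0 + b0) powr m * (f T0 (x T0) - f T0 u)
        - (T + b0) powr m * (f T (x T) - f T u)
        + 2 * L * (T0 + b0) powr (m + 1) / (- m - 1)"
proof -
  note lip = time_varying_cost_Lipschitz[OF cost p]
  have conv: "convex_on UNIV (f t)" and gr: "\<And>y. (f t has_real_derivative g t y) (at y)"
    if "t \<ge> T0" for t using cost that by (auto simp: time_varying_cost_def)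
  have \<alpha>: "(\<alpha> has_real_derivative \<alpha>' t) (at t within {T0..})"
    and \<beta>: "(\<beta> has_real_derivative \<beta>' t) (at t within {T0..})"
    and sig: "exp (\<alpha> t + \<beta> t) - \<beta>' t * exp (\<beta> t) = \<sigma>"
    and e\<beta>: "exp (\<beta> t) = (t + b0) powr m"
    if "t \<ge> T0" for t using par that by (auto simp: nag_parameters_def)
  have pos: "t + b0 > 0" if "t \<ge> T0" for t using nag_parameters_pos[OF par that] .
  have L: "L \<ge> 0" using p[of T0 0] by simp
  have f_cont: "continuous_on UNIV (f t)" if "t \<ge> T0" for t
    using gr[OF that] by (meson DERIV_isCont continuous_at_imp_continuous_on)
  have x_cont: "continuous_on {T0..} x"
    using x DERIV_continuous_on[of "{T0..}" x v] by simp
  show fx_cont: "continuous_on {T0..} (\<lambda>t. f t (x t))"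
    by (rule continuous_on_along_path[OF lip f_cont x_cont]) auto
  have fu_cont: "continuous_on {T0..} (\<lambda>t. f t u)"
    by (rule continuous_on_along_path[OF lip f_cont continuous_on_const]) auto
  have h_cont: "continuous_on {T0..T} (\<lambda>t. f t (x t) - f t u)"
    by (intro continuous_intros continuous_on_subset[OF fx_cont] continuous_on_subset[OF fu_cont]) auto

  define z where "z = (\<lambda>t. x t + exp (- \<alpha> t) * v t)"
  have z: "(z has_real_derivative - exp (\<alpha> t + \<beta> t) * g t (x t)) (at t within {T0..})"
    if t: "t \<ge> T0" for t
  proof -
    have "(z has_real_derivative v t + (exp (- \<alpha> t) * - \<alpha>' t * v t + a t * exp (- \<alpha> t))) (at t within {T0..})"
      unfolding z_def by (intro DERIV_add DERIV_mult x v \<alpha> t DERIV_chain2[OF DERIV_exp] DERIV_minus)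
    \<comment> \<open>After multiplication by \<open>exp (- \<alpha> t)\<close> all terms in
      \<open>v t\<close> cancel in the derivative of \<open>z\<close>.\<close>
    moreover have "a t = (\<alpha>' t - exp (\<alpha> t)) * v t - exp (\<alpha> t) * exp (\<alpha> t + \<beta> t) * g t (x t)"
      using ode[OF t] by (simp add: algebra_simps flip: exp_add)
    then have "v t + (exp (- \<alpha> t) * - \<alpha>' t * v t + a t * exp (- \<alpha> t)) = - exp (\<alpha> t + \<beta> t) * g t (x t)"
      by (simp add: exp_minus field_simps)
    ultimately show ?thesis by simp
  qed

  define I where "I = (\<lambda>s. integral {T0..s} (\<lambda>t. f t (x t) - f t u))"
  \<comment> \<open>An antiderivative of \<open>2 * L * exp (\<beta> s)\<close>, normalized to
    vanish at infinity.\<close>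
  define Q where "Q = (\<lambda>s. 2 * L * (s + b0) powr (m + 1) / (m + 1))"
  \<comment> \<open>\<open>t\<close> is the time of the cost, \<open>s\<close> the time along the
    trajectory.\<close>
  define E where "E = (\<lambda>t s. (z s - u)\<^sup>2 / 2 + exp (\<beta> s) * (f t (x s) - f t u))"
  define W where "W = (\<lambda>s. E s s + \<sigma> * I s - Q s)"
  \<comment> \<open>The cost is frozen at time \<open>t\<close>, as \<open>f\<^sub>t(x(t))\<close> need not be differentiable in \<open>t\<close>; the last
    summand pays for the drift of the cost.\<close>
  define K where "K = (\<lambda>t s. E t s + \<sigma> * I s - Q s + 2 * L * (exp (\<beta> s) * (s - t)))"
  define d where "d = (\<lambda>t. (z t - u) * (- exp (\<alpha> t + \<beta> t) * g t (x t))
      + (exp (\<beta> t) * \<beta>' t * (f t (x t) - f t u) + g t (x t) * v t * exp (\<beta> t))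
      + \<sigma> * (f t (x t) - f t u))"

  have K_deriv: "(K t has_real_derivative d t) (at t within {T0..T})" if t: "t \<in> {T0..T}" for t
  proof -
    have t0: "t \<ge> T0" using t by simp
    have sub: "(h has_real_derivative D) (at t within {T0..T})"
      if "(h has_real_derivative D) (at t within {T0..})" for h D
      by (rule DERIV_subset[OF that]) auto
    have E: "(E t has_real_derivative (z t - u) * (- exp (\<alpha> t + \<beta> t) * g t (x t))
      + (exp (\<beta> t) * \<beta>' t * (f t (x t) - f t u) + g t (x t) * v t * exp (\<beta> t))) (at t within {T0..T})"
      unfolding E_def
      by (rule sub) (auto intro!: derivative_eq_intros z[OF t0] \<beta>[OF t0] x[OF t0] DERIV_chain2[OF gr[OF t0]]
          simp: t0)
    have I: "(I has_real_derivative f t (x t) - f t u) (at t within {T0..T})"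
      unfolding I_def by (rule integral_has_real_derivative[OF h_cont t])
    have Q: "(Q has_real_derivative 2 * L * exp (\<beta> t)) (at t within {T0..T})"
    proof -
      have "((\<lambda>s. (s + b0) powr (m + 1)) has_real_derivative (m + 1) * (t + b0) powr m) (at t within {T0..T})"
        using DERIV_chain'[OF DERIV_add[OF DERIV_ident DERIV_const[of b0]]
            has_real_derivative_powr[OF pos[OF t0], of "m + 1"]] by simp
      from DERIV_cmult[OF this, of "2 * L / (m + 1)"] show ?thesis
        using \<open>m < - 1\<close> by (simp add: Q_def e\<beta>[OF t0] mult.assoc)
    qed
    \<comment> \<open>At \<open>s = t\<close> the term with \<open>\<beta>'\<close> vanishes; what
      remains, times \<open>2 * L\<close>, cancels the derivative of \<open>Q\<close>.\<close>
    have R: "((\<lambda>s. exp (\<beta> s) * (s - t)) has_real_derivative exp (\<beta> t)) (at t within {T0..T})"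
      by (auto intro!: derivative_eq_intros sub[OF \<beta>[OF t0]])
    show ?thesis
      unfolding K_def
      using DERIV_add[OF DERIV_diff[OF DERIV_add[OF E DERIV_cmult[OF I, of \<sigma>]] Q] DERIV_cmult[OF R, of "2 * L"]]
      by (simp add: d_def)
  qed
  have d_nonpos: "d t \<le> 0" if t: "t \<in> {T0..T}" for t
  proof -
    have t0: "t \<ge> T0" using t by simp
    have "g t (x t) * (u - x t) \<le> f t u - f t (x t)"
      by (rule convex_on_imp_above_tangent[OF conv[OF t0], of "x t"]) (use gr[OF t0] in auto)
    then have "exp (\<alpha> t + \<beta> t) * (g t (x t) * (u - x t)) \<le> exp (\<alpha> t + \<beta> t) * (f t u - f t (x t))"
      by simp
    \<comment> \<open>The velocity part of \<open>z t - u\<close> cancels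
      \<open>g t (x t) * v t * exp (\<beta> t)\<close>, and the parameter identity merges the two
      coefficients of the cost gap into \<open>exp (\<alpha> t + \<beta> t)\<close>.\<close>
    moreover have "d t = exp (\<alpha> t + \<beta> t) * (g t (x t) * (u - x t)) - exp (\<alpha> t + \<beta> t) * (f t u - f t (x t))"
      unfolding d_def z_def sig[OF t0, symmetric]
      by (simp add: algebra_simps exp_add exp_minus)
    ultimately show ?thesis by simp
  qed
  have drift: "\<bar>E s s - E t s\<bar> \<le> 2 * L * exp (\<beta> s) * \<bar>s - t\<bar>" if "s \<ge> T0" "t \<ge> T0" for s t
  proof -
    have "E s s - E t s = exp (\<beta> s) * ((f s (x s) - f t (x s)) - (f s u - f t u))"
      by (simp add: E_def algebra_simps)
    moreover have "\<bar>(f s (x s) - f t (x s)) - (f s u - f t u)\<bar> \<le> 2 * L * \<bar>s - t\<bar>"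
      using lip[OF _ that, of "x s"] lip[OF _ that, of u] by linarith
    ultimately show ?thesis
      by (simp add: abs_mult mult_left_mono mult.assoc mult.left_commute)
  qed
  have "W T \<le> W T0"
  proof (rule nonincreasing_if_increments_dominated[OF \<open>T0 \<le> T\<close>])
    show "(K t has_real_derivative d t) (at t within {T0..T}) \<and> d t \<le> 0" if "t \<in> {T0..T}" for t
      using K_deriv d_nonpos that by blast
    \<comment> \<open>The correction in \<open>K t\<close> is zero at \<open>s = t\<close> and
      changes sign there, so it covers the drift on both sides.\<close>
    show "W s - W t \<le> K t s - K t t" if "t \<in> {T0..T}" "s \<in> {T0..T}" "t \<le> s" for s t
      using drift[of s t] that by (auto simp: W_def K_def algebra_simps)
    show "W t - W s \<le> K t t - K t s" if "t \<in> {T0..T}" "s \<in> {T0..T}" "s \<le> t" for s t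
      using drift[of s t] that by (auto simp: W_def K_def algebra_simps)
  qed
  moreover have "Q T \<le> 0"
    using L \<open>m < - 1\<close> by (simp add: Q_def divide_nonneg_neg)
  moreover have "- Q T0 = 2 * L * (T0 + b0) powr (m + 1) / (- m - 1)"
    by (simp add: Q_def minus_divide_right)
  moreover have "(z T - u)\<^sup>2 / 2 \<ge> 0" by simp
  moreover have "\<sigma> * I T0 = 0" by (simp add: I_def)
  ultimately have "\<sigma> * I T \<le> (z T0 - u)\<^sup>2 / 2 + exp (\<beta> T0) * (f T0 (x T0) - f T0 u)
      - exp (\<beta> T) * (f T (x T) - f T u) + 2 * L * (T0 + b0) powr (m + 1) / (- m - 1)"
    unfolding W_def E_def by linarith
  then show "\<sigma> * integral {T0..T} (\<lambda>t. f t (x t) - f t u) \<le>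
      (x T0 + exp (- \<alpha> T0) * v T0 - u)\<^sup>2 / 2
        + (T0 + b0) powr m * (f T0 (x T0) - f T0 u)
        - (T + b0) powr m * (f T (x T) - f T u)
        + 2 * L * (T0 + b0) powr (m + 1) / (- m - 1)"
    using e\<beta>[of T0] e\<beta>[of T] \<open>T0 \<le> T\<close> by (simp add: I_def z_def)
qed

section \<open>Combining the two comparisons\<close>

theorem theorem2:
  fixes T0 \<sigma> m b0 c1 :: real
    and f grad_f dt_f :: "real \<Rightarrow> real \<Rightarrow> real"
    and xstar xtilde x \<alpha> \<alpha>' \<beta> \<beta>' :: "real \<Rightarrow> real"
  assumes cost: "time_varying_cost T0 f grad_f dt_f"
    and A1_argmin: "\<forall>t\<ge>T0. is_arg_min (f t) (\<lambda>_. True) (xstar t)"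
    and A1_bounded: "\<exists>c0>0. \<forall>T>T0. \<forall>t\<in>{T0..T}. \<bar>xstar t\<bar> \<le> c0"
    and A2_argmin: "\<forall>T>T0. is_arg_min (\<lambda>y. integral {T0..T} (\<lambda>t. f t y)) (\<lambda>_. True) (xtilde T)"
    and A2_bounded: "\<exists>C. \<forall>T>T0. \<bar>xtilde T\<bar> \<le> C"
    and A3: "\<forall>R. \<exists>B. \<forall>T>T0. \<forall>t\<in>{T0..T}. \<forall>y. \<bar>y\<bar> \<le> R \<longrightarrow> \<bar>f t y\<bar> \<le> B"
    and A4: "\<exists>L. \<forall>T>T0. \<forall>t\<in>{T0..T}. \<forall>y. \<bar>dt_f t y\<bar> \<le> L"
    and c1_pos: "c1 > 0"
    and c1_bound: "\<forall>t\<ge>T0. \<bar>f t (xstar t) - f t (xtilde t)\<bar> \<le> c1"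
    and \<sigma>_pos: "\<sigma> > 0"
    and m_less: "m < - 1"
    and b0_pos: "b0 > 0"
    and b0_greater: "b0 > (- m / \<sigma>) powr (1 / (1 - m))"
    and parameters: "nag_parameters T0 \<sigma> m b0 \<alpha> \<alpha>' \<beta> \<beta>'"
    and solution: "oct_nag_solution T0 grad_f \<alpha> \<alpha>' \<beta> x"
  shows "\<exists>c>0. \<forall>T>T0.
      (\<lambda>t. f t (x t) - f t (xstar t)) integrable_on {T0..T} \<and>
      integral {T0..T} (\<lambda>t. f t (x t) - f t (xstar t)) \<le> (T - T0) * c1 + c / \<sigma>"
proof -
  from A4 obtain L where "\<And>T t y. \<lbrakk>T > T0; t \<in> {T0..T}\<rbrakk> \<Longrightarrow> \<bar>dt_f t y\<bar> \<le> L" by blast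
  \<comment> \<open>Every \<open>t \<ge> T0\<close> lies in the window with horizon
    \<open>t + 1\<close>.\<close>
  then have L: "\<bar>dt_f t y\<bar> \<le> L" if "t \<ge> T0" for t y
    using that by (meson atLeastAtMost_iff less_add_one less_imp_le order_le_less_trans)
  from A2_bounded obtain C where C: "\<And>T. T > T0 \<Longrightarrow> \<bar>xtilde T\<bar> \<le> C" by blast
  from A3 obtain B where "\<And>T t y. \<lbrakk>T > T0; t \<in> {T0..T}; \<bar>y\<bar> \<le> C\<rbrakk> \<Longrightarrow> \<bar>f t y\<bar> \<le> B" by blast
  then have B: "\<bar>f T0 y\<bar> \<le> B" if "\<bar>y\<bar> \<le> C" for y
    using that by (meson atLeastAtMost_iff less_add_one less_imp_le order_refl)
  from solution obtain v a where
    x: "\<And>t. t \<ge> T0 \<Longrightarrow> (x has_real_derivative v t) (at t within {T0..})" and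
    v: "\<And>t. t \<ge> T0 \<Longrightarrow> (v has_real_derivative a t) (at t within {T0..})" and
    ode: "\<And>t. t \<ge> T0 \<Longrightarrow>
      a t + (exp (\<alpha> t) - \<alpha>' t) * v t + exp (2 * \<alpha> t + \<beta> t) * grad_f t (x t) = 0"
    unfolding oct_nag_solution_def by blast
  have min: "f t (xstar t) \<le> f t y" if "t \<ge> T0" for t y
    using A1_argmin that by (auto simp: is_arg_min_linorder)
  have leader: "integral {T0..t} (\<lambda>s. f s (xtilde t)) \<le> integral {T0..t} (\<lambda>s. f s y)" if "t > T0" for t y
    using A2_argmin that by (auto simp: is_arg_min_linorder)
  have near: "f t (xtilde t) \<le> f t (xstar t) + c1" if "t \<ge> T0" for t
    using c1_bound that by (auto simp: abs_le_iff)
  note lip = time_varying_cost_Lipschitz[OF cost L]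
  note static = static_optimum_le_pointwise_optimum[OF _ lip min leader near]
  note regret = nag_static_regret[OF cost L parameters m_less x v ode]
  define z where "z = x T0 + exp (- \<alpha> T0) * v T0"
  \<comment> \<open>The summands bound the initial distance, the initial cost gap, the terminal cost
    gap and the total drift, uniformly in the horizon.\<close>
  define c where "c = (\<bar>z\<bar> + C)\<^sup>2 / 2 + (T0 + b0) powr m * (\<bar>f T0 (x T0)\<bar> + B)
    + (T0 + b0) powr m * c1 + 2 * L * (T0 + b0) powr (m + 1) / (- m - 1)"
  have pos: "T0 + b0 > 0" by (rule nag_parameters_pos[OF parameters order_refl])
  have "L \<ge> 0" using L[of T0 0] by simp
  have "C \<ge> 0" using C[of "T0 + 1"] by simp
  then have "B \<ge> 0" using B[of 0] by simp
  have "c > 0"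
  proof -
    have "(T0 + b0) powr m * c1 > 0" using pos c1_pos by simp
    moreover have "2 * L * (T0 + b0) powr (m + 1) / (- m - 1) \<ge> 0"
      using \<open>L \<ge> 0\<close> m_less by simp
    moreover have "(T0 + b0) powr m * (\<bar>f T0 (x T0)\<bar> + B) \<ge> 0" using \<open>B \<ge> 0\<close> by simp
    ultimately show ?thesis
      unfolding c_def by (smt (verit) divide_nonneg_pos zero_le_power2)
  qed
  moreover have "(\<lambda>t. f t (x t) - f t (xstar t)) integrable_on {T0..T} \<and>
      integral {T0..T} (\<lambda>t. f t (x t) - f t (xstar t)) \<le> (T - T0) * c1 + c / \<sigma>"
    if T: "T > T0" for T
  proof -
    \<comment> \<open>The comparator depends on the horizon, but its bound \<open>C\<close> does
      not.\<close>
    define u where "u = xtilde T"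
    have T': "T0 \<le> T" "T \<ge> T0" using T by auto
    have int: "h integrable_on {T0..T}" if "continuous_on {T0..} h" for h :: "real \<Rightarrow> real"
      by (rule integrable_continuous_interval, rule continuous_on_subset[OF that]) auto
    have fx: "(\<lambda>t. f t (x t)) integrable_on {T0..T}" by (rule int[OF regret(1)[OF _ _ _ _ T'(1)]])
    have fs: "(\<lambda>t. f t (xstar t)) integrable_on {T0..T}" by (rule int[OF static(1)[OF T'(1)]])
    have "continuous_on {T0..} (\<lambda>t. f t u)"
      using cost unfolding time_varying_cost_def
      by (intro DERIV_continuous_on[of _ _ "\<lambda>t. dt_f t u"]) auto
    then have fu: "(\<lambda>t. f t u) integrable_on {T0..T}" by (rule int)
    have u: "\<bar>u\<bar> \<le> C" using C[OF T] by (simp add: u_def)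
    have "(z - u)\<^sup>2 \<le> (\<bar>z\<bar> + C)\<^sup>2"
      by (rule abs_le_square_iff[THEN iffD1]) (use u \<open>C \<ge> 0\<close> in auto)
    moreover have "(T0 + b0) powr m * (f T0 (x T0) - f T0 u) \<le> (T0 + b0) powr m * (\<bar>f T0 (x T0)\<bar> + B)"
      using B[OF u] by (intro mult_left_mono) auto
    moreover have "- ((T + b0) powr m * (f T (x T) - f T u)) \<le> (T0 + b0) powr m * c1"
    proof -
      \<comment> \<open>At its own horizon \<open>u\<close> is within \<open>c1\<close> of the
        minimum of \<open>f T\<close>; the weight decreases in time as \<open>m\<close> is
        negative.\<close>
      have "f T u - f T (x T) \<le> c1" using near[OF T'(2)] min[OF T'(2), of "x T"] by (simp add: u_def)
      then have "(T + b0) powr m * (f T u - f T (x T)) \<le> (T + b0) powr m * c1"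
        by (intro mult_left_mono) auto
      also have "\<dots> \<le> (T0 + b0) powr m * c1"
        using powr_mono2'[of m "T0 + b0" "T + b0"] m_less pos T c1_pos by (simp add: mult_right_mono)
      finally show ?thesis by (simp add: algebra_simps)
    qed
    ultimately have "\<sigma> * integral {T0..T} (\<lambda>t. f t (x t) - f t u) \<le> c"
      using regret(2)[OF _ _ _ _ T'(1), of u] unfolding c_def z_def by linarith
    then have "integral {T0..T} (\<lambda>t. f t (x t)) - integral {T0..T} (\<lambda>t. f t u) \<le> c / \<sigma>"
      using \<sigma>_pos fx fu by (simp add: integral_diff field_simps)
    moreover have "integral {T0..T} (\<lambda>t. f t u) \<le> integral {T0..T} (\<lambda>t. f t (xstar t)) + (T - T0) * c1"
      using static(2)[OF T'(1)] by (simp add: u_def)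
    ultimately show ?thesis
      using fx fs by (simp add: integral_diff integrable_diff)
  qed
  ultimately show ?thesis by blast
qed

end
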